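(* Let $F,G:\Omega\to\mathcal{H}$ be Bessel mappings for $\mathcal{H}$ with respect to $(\Omega,\mu)$, and let either $F$ or $G$ be norm bounded, i.e. there is a constant $M>0$ such that $\|F(\omega)\|\le M$ for almost every $\omega\in\Omega$, or there is a constant $M>0$ such that $\|G(\omega)\|\le M$ for almost every $\omega\in\Omega$. Let $m:\Omega\to\mathbb{C}$ be an (essentially) bounded measurable function with support of finite measure, i.e. there exists a (measurable) subset $K\subseteq\Omega$ with $\mu(K)<\infty$ such that $m(\omega)=0$ for almost every $\omega\in\Omega\setminus K$. Then $\mathbf{M}_{m,F,G}$ is a compact operator on $\mathcal{H}$.
   Context: $\mathcal{H}$ is a complex Hilbert space with inner product linear in the first and conjugate linear in the second variable, and $(\Omega,\mu)$ is a measure space with positive measure $\mu$. A mapping $F:\Omega\to\mathcal{H}$ is a Bessel mapping with respect to $(\Omega,\mu)$ with Bessel bound $B_F$ if $\omega\mapsto\langle f,F(\omega)\rangle$ is measurable for every $f\in\mathcal{H}$ and $\int_\Omega|\langle f,F(\omega)\rangle|^2\,d\mu(\omega)\le B_F\|f\|^2$ for all $f\in\mathcal{H}$. For Bessel mappings $F,G$ and measurable $m:\Omega\to\mathbb{C}$, the continuous Bessel multiplier $\mathbf{M}_{m,F,G}:\mathcal{H}\to\mathcal{H}$ with symbol $m$ is the operator weakly defined by $\langle\mathbf{M}_{m,F,G}f,g\rangle=\int_\Omega m(\omega)\langle f,F(\omega)\rangle\langle G(\omega),g\rangle\,d\mu(\omega)$ for all $f,g\in\mathcal{H}$. *)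

theory Defs
  imports "HOL-Analysis.Analysis"
begin

text \<open>
  Complex inner product spaces. The inner product is linear in the first and conjugate linear
  in the second argument. The underlying real normed space is that of the library, so that
  its topology and completeness are available; \<open>scaleR_scaleC\<close> and \<open>norm_eq_sqrt_cinner\<close>
  tie that structure to the complex one.
\<close>

class complex_inner = real_normed_vector +
  fixes scaleC :: "complex \<Rightarrow> 'a \<Rightarrow> 'a" (infixr \<open>*\<^sub>C\<close> 75)
    and cinner :: "'a \<Rightarrow> 'a \<Rightarrow> complex"
  assumes scaleC_add_right: "a *\<^sub>C (x + y) = a *\<^sub>C x + a *\<^sub>C y"
    and scaleC_add_left: "(a + b) *\<^sub>C x = a *\<^sub>C x + b *\<^sub>C x"
    and scaleC_scaleC: "a *\<^sub>C b *\<^sub>C x = (a * b) *\<^sub>C x"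
    and scaleC_one: "1 *\<^sub>C x = x"
    and scaleR_scaleC: "r *\<^sub>R x = complex_of_real r *\<^sub>C x"
    and cinner_add_left: "cinner (x + y) z = cinner x z + cinner y z"
    and cinner_scaleC_left: "cinner (a *\<^sub>C x) y = a * cinner x y"
    and cinner_commute: "cinner x y = cnj (cinner y x)"
    and cinner_ge_zero: "0 \<le> Re (cinner x x)"
    and cinner_eq_zero_iff: "cinner x x = 0 \<longleftrightarrow> x = 0"
    and norm_eq_sqrt_cinner: "norm x = sqrt (Re (cinner x x))"

class chilbert_space = complex_inner + complete_space

instantiation complex :: chilbert_space
begin

definition scaleC_complex :: "complex \<Rightarrow> complex \<Rightarrow> complex"
  where "scaleC_complex a x = a * x"

definition cinner_complex :: "complex \<Rightarrow> complex \<Rightarrow> complex"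
  where "cinner_complex x y = x * cnj y"

instance
  by standard
    (auto simp: scaleC_complex_def cinner_complex_def algebra_simps scaleR_conv_of_real
      cmod_def power2_eq_square)

end

definition bessel_bound ::
    "'w measure \<Rightarrow> ('w \<Rightarrow> 'h::chilbert_space) \<Rightarrow> real \<Rightarrow> bool"
  where "bessel_bound \<mu> F B \<longleftrightarrow> 0 \<le> B \<and>
    (\<forall>f. (\<integral>\<^sup>+\<omega>. ennreal ((cmod (cinner f (F \<omega>)))\<^sup>2) \<partial>\<mu>) \<le> ennreal (B * (norm f)\<^sup>2))"

definition bessel_mapping :: "'w measure \<Rightarrow> ('w \<Rightarrow> 'h::chilbert_space) \<Rightarrow> bool"
  where "bessel_mapping \<mu> F \<longleftrightarrow>
    (\<forall>f. (\<lambda>\<omega>. cinner f (F \<omega>)) \<in> borel_measurable \<mu>) \<and> (\<exists>B. bessel_bound \<mu> F B)"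

definition ae_norm_bounded :: "'w measure \<Rightarrow> ('w \<Rightarrow> 'h::real_normed_vector) \<Rightarrow> bool"
  where "ae_norm_bounded \<mu> F \<longleftrightarrow> (\<exists>C>0. AE \<omega> in \<mu>. norm (F \<omega>) \<le> C)"

text \<open>
  The defining weak identity of the multiplier. Integrability is demanded explicitly because
  the library integral of a non-integrable function is the junk value 0.
\<close>

definition is_bessel_multiplier ::
    "'w measure \<Rightarrow> ('w \<Rightarrow> complex) \<Rightarrow> ('w \<Rightarrow> 'h::chilbert_space) \<Rightarrow> ('w \<Rightarrow> 'h) \<Rightarrow> ('h \<Rightarrow> 'h) \<Rightarrow> bool"
  where "is_bessel_multiplier \<mu> m F G T \<longleftrightarrow>
    (\<forall>f g. integrable \<mu> (\<lambda>\<omega>. m \<omega> * cinner f (F \<omega>) * cinner (G \<omega>) g) \<and>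
      cinner (T f) g = (\<integral>\<omega>. m \<omega> * cinner f (F \<omega>) * cinner (G \<omega>) g \<partial>\<mu>))"

definition bessel_multiplier ::
    "'w measure \<Rightarrow> ('w \<Rightarrow> complex) \<Rightarrow> ('w \<Rightarrow> 'h::chilbert_space) \<Rightarrow> ('w \<Rightarrow> 'h) \<Rightarrow> 'h \<Rightarrow> 'h"
  where "bessel_multiplier \<mu> m F G = (THE T. is_bessel_multiplier \<mu> m F G T)"

text \<open>Boundedness of a compact operator follows from relative compactness of the image of the
  unit ball.\<close>

definition compact_operator :: "('h::chilbert_space \<Rightarrow> 'h) \<Rightarrow> bool"
  where "compact_operator T \<longleftrightarrow>
    Vector_Spaces.linear (*\<^sub>C) (*\<^sub>C) T \<and> compact (closure (T ` cball 0 1))"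

end

theory Submission
  imports Defs "HOL-Library.Diagonal_Subsequence"
begin

text \<open>
  Write \<open>M\<close> for the multiplier. It exists, is unique and is bounded because the Cauchy--Schwarz
  inequality in \<open>L\<^sup>2\<close> makes its defining form bounded, so that the Riesz representation theorem
  produces the value of \<open>M\<close> at each vector.

  Suppose first that \<open>F\<close> is norm bounded. Since the symbol vanishes off \<open>K\<close>, testing the weak
  identity against \<open>M h\<close> itself and cancelling one factor \<open>norm (M h)\<close> bounds \<open>norm (M h)\<close> by a
  constant times the \<open>L\<^sup>2(K)\<close> norm of \<open>\<lambda>\<omega>. cinner h (F \<omega>)\<close>
  (\<open>norm_multiplier_le_on_support\<close>). A bounded sequence in the Hilbert space has a subsequence
  along which all inner products with a fixed vector converge
  (\<open>bounded_seq_weakly_convergent_subseq\<close>), in particular those with \<open>F \<omega>\<close>, for every \<open>\<omega>\<close>.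
  As \<open>F\<close> is bounded and \<open>K\<close> has finite measure, these functions are dominated on \<open>K\<close> by a
  constant, which is square integrable there, so they converge in \<open>L\<^sup>2(K)\<close>. Hence \<open>M\<close> maps the
  subsequence to a Cauchy sequence.

  If \<open>G\<close> is bounded instead, the adjoint \<open>M\<^sup>*\<close> is the multiplier with conjugate symbol and with
  \<open>F\<close> and \<open>G\<close> exchanged, to which the first case applies. Compactness passes back to \<open>M\<close> because
  \<open>norm (M h) ^ 2 = cinner h (M\<^sup>* (M h))\<close>, so that a subsequence made convergent by the operator
  \<open>M\<^sup>* M\<close> is made Cauchy by \<open>M\<close>.

  The Riesz theorem and the extraction of the subsequence both rest on the orthogonal projection
  onto a closed subspace (\<open>orthogonal_projection_exists\<close>).
\<close>

section \<open>Elementary facts on complex inner products\<close>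

lemma scaleC_minus_one: "(- 1) *\<^sub>C x = - (x :: 'h::complex_inner)"
  using scaleR_scaleC[of "-1" x] by simp

lemma scaleC_zero_left: "0 *\<^sub>C x = (0 :: 'h::complex_inner)"
  using scaleR_scaleC[of 0 x] by simp

lemma cinner_zero_left: "cinner 0 (y :: 'h::complex_inner) = 0"
  using cinner_scaleC_left[of 0 0 y] by (simp add: scaleC_zero_left)

lemma cinner_minus_left: "cinner (- x) (y :: 'h::complex_inner) = - cinner x y"
  using cinner_scaleC_left[of "- 1" x y] by (simp add: scaleC_minus_one)

lemma cinner_diff_left: "cinner (x - y) (z :: 'h::complex_inner) = cinner x z - cinner y z"
  using cinner_add_left[of x "- y" z] by (simp add: cinner_minus_left)

lemma cinner_add_right: "cinner x (y + z) = cinner x y + cinner x (z :: 'h::complex_inner)"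
  by (metis cinner_add_left cinner_commute complex_cnj_add)

lemma cinner_scaleC_right: "cinner x (a *\<^sub>C y) = cnj a * cinner x (y :: 'h::complex_inner)"
  by (metis cinner_commute cinner_scaleC_left complex_cnj_mult)

lemma cinner_zero_right: "cinner (x :: 'h::complex_inner) 0 = 0"
  by (metis cinner_commute cinner_zero_left complex_cnj_zero)

lemma cinner_diff_right: "cinner x (y - z) = cinner x y - cinner x (z :: 'h::complex_inner)"
  by (metis cinner_commute cinner_diff_left complex_cnj_diff)

lemma cmod_cinner_commute: "cmod (cinner x y) = cmod (cinner y (x :: 'h::complex_inner))"
  by (metis cinner_commute complex_mod_cnj)

lemma cinner_self: "cinner x x = of_real ((norm (x :: 'h::complex_inner))\<^sup>2)"
proof -
  have "Im (cinner x x) = 0"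
    using cinner_commute[of x x] by (metis Im_complex_of_real Reals_cnj_iff complex_is_Real_iff)
  then show ?thesis
    by (simp add: complex_eq_iff norm_eq_sqrt_cinner cinner_ge_zero)
qed

lemma norm_diff_squared:
  "(norm (x - y))\<^sup>2 = (norm x)\<^sup>2 - 2 * Re (cinner x y) + (norm (y :: 'h::complex_inner))\<^sup>2"
proof -
  have "cinner (x - y) (x - y) = cinner x x - cinner x y - cnj (cinner x y) + cinner y y"
    by (simp add: cinner_diff_left cinner_diff_right flip: cinner_commute)
  from arg_cong[OF this, of Re] show ?thesis
    by (simp add: cinner_self)
qed

lemma parallelogram_law:
  "(norm (x + y))\<^sup>2 + (norm (x - y))\<^sup>2 = 2 * (norm x)\<^sup>2 + 2 * (norm (y :: 'h::complex_inner))\<^sup>2"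
  using norm_diff_squared[of x y] norm_diff_squared[of x "- y"]
  by (simp add: cinner_minus_left cinner_commute[of x "- y"] cinner_commute[of x y])

lemma norm_diff_squared_le: "(norm (x - y))\<^sup>2 \<le> 2 * (norm x)\<^sup>2 + 2 * (norm (y :: 'h::complex_inner))\<^sup>2"
  unfolding parallelogram_law[symmetric] by simp

lemma norm_scaleC: "norm (a *\<^sub>C x) = cmod a * norm (x :: 'h::complex_inner)"
proof -
  have "cinner (a *\<^sub>C x) (a *\<^sub>C x) = (a * cnj a) * cinner x x"
    by (simp add: cinner_scaleC_left cinner_scaleC_right)
  then have "complex_of_real ((norm (a *\<^sub>C x))\<^sup>2) = of_real ((cmod a * norm x)\<^sup>2)"
    by (simp add: cinner_self power_mult_distrib flip: complex_norm_square)
  then have "(norm (a *\<^sub>C x))\<^sup>2 = (cmod a * norm x)\<^sup>2"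
    using of_real_eq_iff by blast
  then show ?thesis
    by (simp add: power2_eq_iff_nonneg)
qed

text \<open>
  Moving \<open>x\<close> along \<open>y\<close> in the phase of \<open>cinner x y\<close> turns the cross term into a real multiple of
  \<open>cmod (cinner x y) ^ 2\<close>. The choice of the real parameter \<open>s\<close> then gives both the
  Cauchy--Schwarz inequality and the orthogonality of a nearest point.
\<close>

lemma norm_diff_scaleC_squared:
  fixes x y :: "'h::complex_inner" and s :: real
  shows "(norm (x - (of_real s * cinner x y) *\<^sub>C y))\<^sup>2
    = (norm x)\<^sup>2 - 2 * s * (cmod (cinner x y))\<^sup>2 + s\<^sup>2 * (cmod (cinner x y))\<^sup>2 * (norm y)\<^sup>2"
proof -
  have "cinner x ((of_real s * cinner x y) *\<^sub>C y) = of_real (s * (cmod (cinner x y))\<^sup>2)"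
    using complex_norm_square[of "cinner x y"] by (simp add: cinner_scaleC_right mult_ac)
  then show ?thesis
    by (simp add: norm_diff_squared norm_scaleC norm_mult power_mult_distrib)
qed

lemma cinner_Cauchy_Schwarz: "cmod (cinner x y) \<le> norm x * norm (y :: 'h::complex_inner)"
proof (cases "y = 0")
  case False
  \<comment> \<open>With this coefficient the subtracted vector is the projection of \<open>x\<close> onto the line of \<open>y\<close>.\<close>
  have "0 \<le> (norm (x - (of_real (1 / (norm y)\<^sup>2) * cinner x y) *\<^sub>C y))\<^sup>2"
    by simp
  also have "\<dots> = (norm x)\<^sup>2 - (cmod (cinner x y))\<^sup>2 / (norm y)\<^sup>2"
    unfolding norm_diff_scaleC_squared using False by (simp add: field_simps power2_eq_square)
  finally have "(cmod (cinner x y))\<^sup>2 \<le> (norm x * norm y)\<^sup>2"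
    using False by (simp add: field_simps power_mult_distrib)
  then show ?thesis
    by (rule power2_le_imp_le) simp
qed (simp add: cinner_zero_right)

lemma cinner_eqI: "(\<And>z. cinner x z = cinner y z) \<Longrightarrow> x = (y :: 'h::complex_inner)"
  by (metis cinner_diff_left cinner_eq_zero_iff eq_iff_diff_eq_0)

lemma vector_space_scaleC: "vector_space ((*\<^sub>C) :: complex \<Rightarrow> 'h::complex_inner \<Rightarrow> 'h)"
  by unfold_locales (auto simp: scaleC_add_right scaleC_add_left scaleC_scaleC scaleC_one)

section \<open>Cauchy sequences and relatively compact sets\<close>

text \<open>
  Minimising sequences, dominated convergence and the adjoint argument all control the squared
  distance of two members by the sum of two terms of a null sequence; this turns such a bound into Cauchyness.
\<close>

lemma Cauchy_if_norm_squared_le: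
  fixes x :: "nat \<Rightarrow> 'a::real_normed_vector" and a :: "nat \<Rightarrow> real"
  assumes le: "\<And>n k. (norm (x n - x k))\<^sup>2 \<le> a n + a k" and "a \<longlonglongrightarrow> 0"
  shows "Cauchy x"
proof (rule metric_CauchyI)
  fix e :: real assume "0 < e"
  then have "0 < e\<^sup>2 / 2" by simp
  with \<open>a \<longlonglongrightarrow> 0\<close> have "\<forall>\<^sub>F n in sequentially. a n < e\<^sup>2 / 2"
    by (rule order_tendstoD(2))
  then obtain N where N: "\<And>n. n \<ge> N \<Longrightarrow> a n < e\<^sup>2 / 2"
    unfolding eventually_sequentially by blast
  have "dist (x n) (x k) < e" if "n \<ge> N" "k \<ge> N" for n k
  proof -
    have "(norm (x n - x k))\<^sup>2 < e\<^sup>2"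
      using le[of n k] N[OF that(1)] N[OF that(2)] by simp
    then show ?thesis
      using \<open>0 < e\<close> by (simp add: dist_norm power_less_imp_less_base)
  qed
  then show "\<exists>N. \<forall>n\<ge>N. \<forall>k\<ge>N. dist (x n) (x k) < e" by blast
qed

lemma compact_closure_if_Cauchy_subseq:
  fixes S :: "'a::complete_space set"
  assumes sub: "\<And>x. (\<And>n. x n \<in> S) \<Longrightarrow> \<exists>r :: nat \<Rightarrow> nat. strict_mono r \<and> Cauchy (x \<circ> r)"
  shows "compact (closure S)"
  unfolding compact_def
proof (intro allI impI)
  fix y :: "nat \<Rightarrow> 'a" assume y: "\<forall>n. y n \<in> closure S"
  have "\<exists>x\<in>S. dist x (y n) < inverse (Suc n)" for n
    using y closure_approachable by (metis inverse_positive_iff_positive of_nat_0_less_iff zero_less_Suc)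
  then obtain x where x: "\<And>n. x n \<in> S" and near: "\<And>n. dist (x n) (y n) < inverse (Suc n)"
    by metis
  obtain r where r: "strict_mono r" and "Cauchy (x \<circ> r)"
    using sub[of x, OF x] by blast
  then obtain l where l: "(x \<circ> r) \<longlonglongrightarrow> l"
    using Cauchy_convergent convergent_def by blast
  have "(\<lambda>n. inverse (real (Suc (r n)))) \<longlonglongrightarrow> 0"
    using LIMSEQ_subseq_LIMSEQ[OF LIMSEQ_inverse_real_of_nat r] by (simp add: comp_def)
  moreover have "(\<lambda>n. dist (x (r n)) l) \<longlonglongrightarrow> 0"
    using iffD1[OF tendsto_dist_iff l] by (simp only: comp_def)
  ultimately have bound_null: "(\<lambda>n. inverse (real (Suc (r n))) + dist (x (r n)) l) \<longlonglongrightarrow> 0"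
    by (rule tendsto_add_zero)
  have "norm (dist (y (r n)) l) \<le> inverse (real (Suc (r n))) + dist (x (r n)) l" for n
    using dist_triangle3[of "y (r n)" l "x (r n)"] near[of "r n"] by simp
  then have "(\<lambda>n. dist (y (r n)) l) \<longlonglongrightarrow> 0"
    by (intro Lim_null_comparison[OF _ bound_null] always_eventually allI)
  then have lim: "(y \<circ> r) \<longlonglongrightarrow> l"
    by (subst tendsto_dist_iff) (simp only: comp_def)
  have "l \<in> closure S"
    by (rule closed_sequentially[OF closed_closure _ lim]) (use y in simp)
  with r lim show "\<exists>l\<in>closure S. \<exists>r. strict_mono r \<and> (y \<circ> r) \<longlonglongrightarrow> l" by blast
qed

section \<open>Orthogonal projection and the Riesz representation theorem\<close>

text \<open>
  The projection \<open>p\<close> is a point of \<open>V\<close> nearest to \<open>h\<close>. A minimising sequence is Cauchy by the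
  parallelogram law, since midpoints stay in \<open>V\<close> and thus cannot be much closer to \<open>h\<close>. Moving \<open>p\<close>
  slightly inside \<open>V\<close> cannot reduce the distance either, which forces orthogonality.
\<close>

lemma orthogonal_projection_exists:
  fixes V :: "'h::chilbert_space set" and h :: 'h
  assumes "closed V" and "0 \<in> V"
    and add: "\<And>x y. x \<in> V \<Longrightarrow> y \<in> V \<Longrightarrow> x + y \<in> V"
    and scale: "\<And>a x. x \<in> V \<Longrightarrow> a *\<^sub>C x \<in> V"
  obtains p where "p \<in> V" and "\<And>v. v \<in> V \<Longrightarrow> cinner (h - p) v = 0"
proof -
  define d where "d = (INF v\<in>V. (norm (h - v))\<^sup>2)"
  have bdd: "bdd_below ((\<lambda>v. (norm (h - v))\<^sup>2) ` V)"
    by (rule bdd_belowI2[of _ 0]) simp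
  have d_le: "d \<le> (norm (h - v))\<^sup>2" if "v \<in> V" for v
    unfolding d_def by (rule cINF_lower[OF bdd that])
  have "\<exists>v\<in>V. (norm (h - v))\<^sup>2 < d + 1 / Suc n" for n
  proof (rule ccontr)
    assume "\<not> ?thesis"
    then have "d + 1 / Suc n \<le> d"
      unfolding d_def using \<open>0 \<in> V\<close> by (intro cINF_greatest) (auto simp: not_less d_def)
    then show False by simp
  qed
  then obtain v where v: "\<And>n. v n \<in> V" and v_lt: "\<And>n. (norm (h - v n))\<^sup>2 < d + 1 / Suc n"
    by metis
  have close: "(norm (v n - v k))\<^sup>2 \<le> 2 / Suc n + 2 / Suc k" for n k
  proof -
    have "(1/2) *\<^sub>C (v n + v k) \<in> V"
      by (intro scale add v)
    moreover have "(h - v k) + (h - v n) = 2 *\<^sub>R (h - (1/2) *\<^sub>R (v n + v k))"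
      by (simp add: algebra_simps scaleR_2)
    then have "norm ((h - v k) + (h - v n)) = 2 * norm (h - (1/2) *\<^sub>C (v n + v k))"
      by (simp add: scaleR_scaleC[of "1/2"])
    ultimately have "4 * d \<le> (norm ((h - v k) + (h - v n)))\<^sup>2"
      using d_le by (simp add: power_mult_distrib)
    then show ?thesis
      using parallelogram_law[of "h - v k" "h - v n"] v_lt[of n] v_lt[of k] by simp
  qed
  have "(\<lambda>n. 2 / Suc n) \<longlonglongrightarrow> 0"
    using tendsto_mult_right_zero[OF LIMSEQ_inverse_real_of_nat, of 2]
    by (simp add: inverse_eq_divide)
  with close have "Cauchy v"
    by (rule Cauchy_if_norm_squared_le)
  then obtain p where lim: "v \<longlonglongrightarrow> p"
    using Cauchy_convergent convergent_def by blast
  have "p \<in> V"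
    using \<open>closed V\<close> v lim closed_sequentially by blast
  have "(norm (h - p))\<^sup>2 \<le> d"
  proof (rule LIMSEQ_le)
    show "(\<lambda>n. (norm (h - v n))\<^sup>2) \<longlonglongrightarrow> (norm (h - p))\<^sup>2"
      by (intro tendsto_intros lim)
    show "(\<lambda>n. d + 1 / Suc n) \<longlonglongrightarrow> d"
      using tendsto_add[OF tendsto_const[of d] LIMSEQ_inverse_real_of_nat]
      by (simp add: inverse_eq_divide)
  qed (use v_lt less_imp_le in blast)
  have "cinner (h - p) w = 0" if "w \<in> V" for w
  proof -
    define t where "t = (cmod (cinner (h - p) w))\<^sup>2"
    \<comment> \<open>A step so small that the quadratic term is at most half of the linear gain.\<close>
    define s where "s = 1 / ((norm w)\<^sup>2 + 1)"
    have "0 < (norm w)\<^sup>2 + 1"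
      by (simp add: add_nonneg_pos)
    then have s: "0 < s" "s * (norm w)\<^sup>2 \<le> 1"
      by (simp_all add: s_def pos_divide_le_eq)
    have "p + (of_real s * cinner (h - p) w) *\<^sub>C w \<in> V"
      by (intro add scale \<open>p \<in> V\<close> that)
    then have "d \<le> (norm ((h - p) - (of_real s * cinner (h - p) w) *\<^sub>C w))\<^sup>2"
      using d_le by (simp add: diff_diff_eq)
    also have "\<dots> = (norm (h - p))\<^sup>2 - 2 * s * t + s * t * (s * (norm w)\<^sup>2)"
      unfolding norm_diff_scaleC_squared t_def by (simp add: power2_eq_square)
    also have "\<dots> \<le> d - 2 * s * t + s * t * 1"
      using s \<open>_ \<le> d\<close> by (intro add_mono diff_mono mult_left_mono) (auto simp: t_def)
    finally have "s * t \<le> 0" by simp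
    then have "t \<le> 0"
      using s(1) by (simp add: mult_le_0_iff)
    then show ?thesis by (simp add: t_def)
  qed
  with \<open>p \<in> V\<close> that show thesis by blast
qed

text \<open>
  If \<open>\<phi>\<close> is not zero, subtracting from some \<open>h\<close> with \<open>\<phi> h \<noteq> 0\<close> its projection onto the closed
  kernel leaves a vector \<open>q\<close> orthogonal to the kernel. Every \<open>x\<close> differs from a multiple of \<open>q\<close> by
  an element of the kernel, so a multiple of \<open>q\<close> represents \<open>\<phi>\<close>.
\<close>

lemma Riesz_representation:
  fixes \<phi> :: "'h::chilbert_space \<Rightarrow> complex"
  assumes add: "\<And>x y. \<phi> (x + y) = \<phi> x + \<phi> y"
    and scale: "\<And>a x. \<phi> (a *\<^sub>C x) = a * \<phi> x"
    and bound: "\<And>x. cmod (\<phi> x) \<le> B * norm x"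
  obtains z where "\<And>x. \<phi> x = cinner x z"
proof (cases "\<forall>x. \<phi> x = 0")
  case True
  with that[of 0] show thesis by (simp add: cinner_zero_right)
next
  case False
  have diff: "\<phi> (x - y) = \<phi> x - \<phi> y" for x y
    using add[of "x - y" y] by simp
  define V where "V = {x. \<phi> x = 0}"
  have zero: "\<phi> 0 = 0"
    using scale[of 0 0] by (simp add: scaleC_zero_left)
  have "bounded_linear \<phi>"
    by (rule bounded_linear_intro[where K = B])
      (auto simp: add scale bound scaleR_scaleC scaleC_complex_def mult.commute)
  then have "continuous_on UNIV \<phi>"
    by (rule linear_continuous_on)
  then have "closed (\<phi> -` {0})"
    by (intro closed_vimage) auto
  then have "closed V"
    by (simp add: V_def vimage_def)
  from False obtain h where h: "\<phi> h \<noteq> 0" by blast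
  obtain p where p: "\<phi> p = 0" and orth: "\<And>v. \<phi> v = 0 \<Longrightarrow> cinner (h - p) v = 0"
    using orthogonal_projection_exists[OF \<open>closed V\<close>, of h] by (auto simp: V_def add scale zero)
  define q where "q = h - p"
  have \<phi>q: "\<phi> q = \<phi> h"
    by (simp add: q_def diff p)
  then have "q \<noteq> 0"
    using h zero by auto
  have "\<phi> x = cinner x ((cnj (\<phi> h) / cinner q q) *\<^sub>C q)" for x
  proof -
    have "\<phi> (x - (\<phi> x / \<phi> h) *\<^sub>C q) = 0"
      using h by (simp add: diff scale \<phi>q)
    then have "cinner (x - (\<phi> x / \<phi> h) *\<^sub>C q) q = 0"
      using orth cinner_commute unfolding q_def by (metis complex_cnj_zero)
    then have "cinner x q = \<phi> x / \<phi> h * cinner q q"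
      by (simp add: cinner_diff_left cinner_scaleC_left)
    moreover have "cnj (cinner q q) = cinner q q"
      by (rule cinner_commute[symmetric])
    ultimately show ?thesis
      using h \<open>q \<noteq> 0\<close> by (simp add: cinner_scaleC_right cinner_eq_zero_iff)
  qed
  then show thesis using that by blast
qed

section \<open>Bounded sequences have weakly Cauchy subsequences\<close>

lemma bounded_complex_seq_convergent_subseq:
  fixes c :: "nat \<Rightarrow> complex"
  assumes "\<And>n. cmod (c n) \<le> B"
  obtains r where "strict_mono r" and "convergent (c \<circ> r)"
proof -
  have "compact (cball 0 B :: complex set)" by simp
  moreover have "\<forall>n. c n \<in> cball 0 B" using assms by simp
  ultimately show thesis
    unfolding compact_def using that by (metis convergent_def)
qed

text \<open>
  The functionals \<open>cinner (f n)\<close> are uniformly equicontinuous when \<open>f\<close> is bounded, so an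
  \<open>\<epsilon>/2\<close>-argument carries convergence over to limits of points where it holds.
\<close>

lemma closed_weak_convergence_set:
  fixes f :: "nat \<Rightarrow> 'h::complex_inner"
  assumes "\<And>n. norm (f n) \<le> L"
  shows "closed {h. convergent (\<lambda>n. cinner (f n) h)}" (is "closed ?V")
proof -
  have "L \<ge> 0" using assms[of 0] norm_ge_zero order_trans by blast
  have "h \<in> ?V" if "h \<in> closure ?V" for h
  proof -
    have "Cauchy (\<lambda>n. cinner (f n) h)"
    proof (rule metric_CauchyI)
      fix e :: real assume "0 < e"
      \<comment> \<open>Differences of members have norm at most \<open>2 * L\<close>; the summand \<open>1\<close> covers \<open>L = 0\<close>.\<close>
      have "0 < e / (2 * (2 * L + 1))" using \<open>0 < e\<close> \<open>L \<ge> 0\<close> by simp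
      then obtain y where y: "y \<in> ?V" "dist y h < e / (2 * (2 * L + 1))"
        using \<open>h \<in> closure ?V\<close> unfolding closure_approachable by blast
      have "Cauchy (\<lambda>n. cinner (f n) y)"
        using y(1) by (simp add: Cauchy_convergent_iff)
      then obtain N where N: "\<And>n k. n \<ge> N \<Longrightarrow> k \<ge> N \<Longrightarrow> dist (cinner (f n) y) (cinner (f k) y) < e / 2"
        using \<open>0 < e\<close> metric_CauchyD[of _ "e / 2"] by (metis half_gt_zero)
      have "dist (cinner (f n) h) (cinner (f k) h) < e" if "n \<ge> N" "k \<ge> N" for n k
      proof -
        have "cinner (f n) h - cinner (f k) h
          = (cinner (f n) y - cinner (f k) y) + cinner (f n - f k) (h - y)"
          by (simp add: cinner_diff_left cinner_diff_right)
        then have "dist (cinner (f n) h) (cinner (f k) h)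
          \<le> dist (cinner (f n) y) (cinner (f k) y) + cmod (cinner (f n - f k) (h - y))"
          unfolding dist_norm by (metis norm_triangle_ineq)
        moreover have "cmod (cinner (f n - f k) (h - y)) \<le> e / 2"
        proof -
          have "norm (f n - f k) \<le> 2 * L"
            using norm_triangle_ineq4[of "f n" "f k"] assms[of n] assms[of k] by linarith
          then have "norm (f n - f k) * norm (h - y) \<le> (2 * L + 1) * (e / (2 * (2 * L + 1)))"
            using y(2) \<open>L \<ge> 0\<close> by (intro mult_mono) (auto simp: dist_norm norm_minus_commute)
          also have "\<dots> = e / 2"
            using \<open>L \<ge> 0\<close> by (simp add: divide_simps)
          finally show ?thesis
            using cinner_Cauchy_Schwarz[of "f n - f k" "h - y"] by linarith
        qed
        ultimately show ?thesis using N[OF that] by linarith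
      qed
      then show "\<exists>N. \<forall>n\<ge>N. \<forall>k\<ge>N. dist (cinner (f n) h) (cinner (f k) h) < e" by blast
    qed
    then show ?thesis by (simp add: Cauchy_convergent_iff)
  qed
  then show ?thesis
    using closure_subset_eq by blast
qed

text \<open>
  The space may be non-separable, so a diagonal sequence can only be chosen to make the inner
  products with the countably many members of the sequence itself converge. This suffices: the
  vectors \<open>h\<close> for which the inner products converge form a closed subspace \<open>V\<close> that contains the
  sequence, and the component of \<open>h\<close> orthogonal to \<open>V\<close> does not change the inner products.
\<close>

lemma bounded_seq_weakly_convergent_subseq:
  fixes f :: "nat \<Rightarrow> 'h::chilbert_space"
  assumes L: "\<And>n. norm (f n) \<le> L"
  shows "\<exists>r :: nat \<Rightarrow> nat. strict_mono r \<and> (\<forall>h. convergent (\<lambda>n. cinner (f (r n)) h))"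
proof -
  define P where "P k s \<longleftrightarrow> convergent (\<lambda>n. cinner (f (s n)) (f k))" for k and s :: "nat \<Rightarrow> nat"
  interpret subseqs P
  proof
    fix k and s :: "nat \<Rightarrow> nat"
    have "cmod (cinner (f (s n)) (f k)) \<le> L * L" for n
      using cinner_Cauchy_Schwarz[of "f (s n)" "f k"] mult_mono[OF L[of "s n"] L[of k]]
        norm_ge_zero L order_trans by (smt (verit))
    then obtain r where "strict_mono r" "convergent ((\<lambda>n. cinner (f (s n)) (f k)) \<circ> r)"
      by (rule bounded_complex_seq_convergent_subseq)
    then show "\<exists>r. strict_mono r \<and> P k (s \<circ> r)"
      by (auto simp: P_def comp_def)
  qed
  define r where "r = diagseq"
  have r: "strict_mono r"
    unfolding r_def by (rule subseq_diagseq)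
  \<comment> \<open>From index \<open>k + 1\<close> on, the diagonal sequence is a subsequence of the one chosen for \<open>f k\<close>.\<close>
  have conv: "convergent (\<lambda>n. cinner (f (r n)) (f k))" for k
  proof -
    have "P k (s \<circ> t)" if "strict_mono t" "P k s" for k s t
      using that convergent_subseq_convergent[of "\<lambda>n. cinner (f (s n)) (f k)" t]
      by (simp add: P_def comp_def)
    then have "P k (diagseq \<circ> ((+) (Suc k)))"
      by (rule diagseq_holds)
    then have "convergent (\<lambda>n. cinner (f (r (n + Suc k))) (f k))"
      by (simp add: P_def comp_def r_def add.commute)
    then show ?thesis
      using convergent_ignore_initial_segment[of "\<lambda>n. cinner (f (r n)) (f k)"] by blast
  qed
  define V where "V = {h. convergent (\<lambda>n. cinner (f (r n)) h)}"
  have "closed V"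
    unfolding V_def by (rule closed_weak_convergence_set) (rule L)
  have "convergent (\<lambda>n. cinner (f (r n)) h)" for h
  proof -
    have "0 \<in> V" by (simp add: V_def cinner_zero_right convergent_const)
    moreover have "x + y \<in> V" if "x \<in> V" "y \<in> V" for x y
      using that by (simp add: V_def cinner_add_right convergent_add)
    moreover have "a *\<^sub>C x \<in> V" if "x \<in> V" for a x
      using that convergent_mult[OF convergent_const] by (simp add: V_def cinner_scaleC_right)
    ultimately obtain p where "p \<in> V" and orth: "\<And>v. v \<in> V \<Longrightarrow> cinner (h - p) v = 0"
      using orthogonal_projection_exists[OF \<open>closed V\<close>] by metis
    have "cinner (f (r n)) (h - p) = 0" for n
      using orth[of "f (r n)"] conv cinner_commute[of "f (r n)" "h - p"] by (simp add: V_def)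
    then have "cinner (f (r n)) h = cinner (f (r n)) p" for n
      by (simp add: cinner_diff_right)
    with \<open>p \<in> V\<close> show ?thesis by (simp add: V_def)
  qed
  with r show ?thesis by blast
qed

section \<open>The Cauchy--Schwarz inequality for weighted products\<close>

text \<open>
  With \<open>a\<close> and \<open>b\<close> the \<open>L\<^sup>2\<close> norms of \<open>u\<close> and \<open>v\<close>, the pointwise inequality
  \<open>2 * (x / a) * (y / b) \<le> (x / a) ^ 2 + (y / b) ^ 2\<close> integrates to the claim; a vanishing norm
  makes the product vanish almost everywhere.
\<close>

lemma
  fixes m u v :: "'w \<Rightarrow> complex"
  assumes meas [measurable]: "m \<in> borel_measurable \<mu>" "u \<in> borel_measurable \<mu>" "v \<in> borel_measurable \<mu>"
    and m: "AE \<omega> in \<mu>. cmod (m \<omega>) \<le> C" and "0 \<le> C"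
    and u: "integrable \<mu> (\<lambda>\<omega>. (cmod (u \<omega>))\<^sup>2)" and v: "integrable \<mu> (\<lambda>\<omega>. (cmod (v \<omega>))\<^sup>2)"
  shows integrable_weighted_product: "integrable \<mu> (\<lambda>\<omega>. m \<omega> * u \<omega> * v \<omega>)"
    and weighted_product_Cauchy_Schwarz: "cmod (\<integral>\<omega>. m \<omega> * u \<omega> * v \<omega> \<partial>\<mu>)
      \<le> C * sqrt (\<integral>\<omega>. (cmod (u \<omega>))\<^sup>2 \<partial>\<mu>) * sqrt (\<integral>\<omega>. (cmod (v \<omega>))\<^sup>2 \<partial>\<mu>)"
proof -
  have weight: "AE \<omega> in \<mu>. cmod (m \<omega> * u \<omega> * v \<omega>) \<le> C * (cmod (u \<omega>) * cmod (v \<omega>))"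
    using m by eventually_elim (simp add: norm_mult mult_right_mono mult.assoc)
  have product: "C * (cmod x * cmod y) \<le> C * ((cmod x)\<^sup>2 + (cmod y)\<^sup>2)" for x y
  proof (rule mult_left_mono[OF _ \<open>0 \<le> C\<close>])
    have "0 \<le> cmod x * cmod y" by simp
    then show "cmod x * cmod y \<le> (cmod x)\<^sup>2 + (cmod y)\<^sup>2"
      using sum_squares_bound[of "cmod x" "cmod y"] by linarith
  qed
  show int: "integrable \<mu> (\<lambda>\<omega>. m \<omega> * u \<omega> * v \<omega>)"
  proof (rule Bochner_Integration.integrable_bound)
    show "integrable \<mu> (\<lambda>\<omega>. C * ((cmod (u \<omega>))\<^sup>2 + (cmod (v \<omega>))\<^sup>2))"
      using u v by simp
    show "AE \<omega> in \<mu>. norm (m \<omega> * u \<omega> * v \<omega>) \<le> norm (C * ((cmod (u \<omega>))\<^sup>2 + (cmod (v \<omega>))\<^sup>2))"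
      using weight
    proof eventually_elim
      case (elim \<omega>)
      then show ?case using product[of "u \<omega>" "v \<omega>"] \<open>0 \<le> C\<close> by simp
    qed
  qed measurable
  define a where "a = sqrt (\<integral>\<omega>. (cmod (u \<omega>))\<^sup>2 \<partial>\<mu>)"
  define b where "b = sqrt (\<integral>\<omega>. (cmod (v \<omega>))\<^sup>2 \<partial>\<mu>)"
  have a: "0 \<le> a" "(\<integral>\<omega>. (cmod (u \<omega>))\<^sup>2 \<partial>\<mu>) = a\<^sup>2" and b: "0 \<le> b" "(\<integral>\<omega>. (cmod (v \<omega>))\<^sup>2 \<partial>\<mu>) = b\<^sup>2"
    by (simp_all add: a_def b_def)
  have "cmod (\<integral>\<omega>. m \<omega> * u \<omega> * v \<omega> \<partial>\<mu>) \<le> C * a * b"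
  proof (cases "a = 0 \<or> b = 0")
    case True
    then have "AE \<omega> in \<mu>. u \<omega> = 0 \<or> v \<omega> = 0"
    proof
      assume "a = 0"
      then have "AE \<omega> in \<mu>. (cmod (u \<omega>))\<^sup>2 = 0"
        using integral_nonneg_eq_0_iff_AE[OF u] a by simp
      then show ?thesis by eventually_elim simp
    next
      assume "b = 0"
      then have "AE \<omega> in \<mu>. (cmod (v \<omega>))\<^sup>2 = 0"
        using integral_nonneg_eq_0_iff_AE[OF v] b by simp
      then show ?thesis by eventually_elim simp
    qed
    then have "AE \<omega> in \<mu>. m \<omega> * u \<omega> * v \<omega> = 0"
      by eventually_elim auto
    then have "(\<integral>\<omega>. m \<omega> * u \<omega> * v \<omega> \<partial>\<mu>) = 0"
      by (rule integral_eq_zero_AE)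
    then show ?thesis using a b \<open>0 \<le> C\<close> by simp
  next
    case False
    then have pos: "0 < a" "0 < b" using a b by auto
    define g where "g \<omega> = C * a * b / 2 * ((cmod (u \<omega>))\<^sup>2 / a\<^sup>2 + (cmod (v \<omega>))\<^sup>2 / b\<^sup>2)" for \<omega>
    have scaled: "C * (x * y) \<le> C * a * b / 2 * (x\<^sup>2 / a\<^sup>2 + y\<^sup>2 / b\<^sup>2)" for x y :: real
    proof -
      have "x * y = a * b / 2 * (2 * (x / a) * (y / b))"
        using pos by simp
      also have "\<dots> \<le> a * b / 2 * ((x / a)\<^sup>2 + (y / b)\<^sup>2)"
        using pos by (intro mult_left_mono sum_squares_bound) simp
      finally show ?thesis
        using mult_left_mono[OF _ \<open>0 \<le> C\<close>] by (fastforce simp: power_divide mult.assoc)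
    qed
    have "cmod (\<integral>\<omega>. m \<omega> * u \<omega> * v \<omega> \<partial>\<mu>) \<le> (\<integral>\<omega>. cmod (m \<omega> * u \<omega> * v \<omega>) \<partial>\<mu>)"
      by (rule integral_norm_bound)
    also have "\<dots> \<le> (\<integral>\<omega>. g \<omega> \<partial>\<mu>)"
    proof (rule integral_mono_AE)
      show "integrable \<mu> g" unfolding g_def using u v by simp
      show "AE \<omega> in \<mu>. cmod (m \<omega> * u \<omega> * v \<omega>) \<le> g \<omega>"
        using weight
      proof eventually_elim
        case (elim \<omega>)
        then show ?case using scaled[of "cmod (u \<omega>)" "cmod (v \<omega>)"] unfolding g_def by linarith
      qed
    qed (use int in simp)
    also have "\<dots> = C * a * b / 2 * (a\<^sup>2 / a\<^sup>2 + b\<^sup>2 / b\<^sup>2)"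
      unfolding g_def using u v by (simp add: a(2) b(2))
    also have "\<dots> = C * a * b"
      using pos by simp
    finally show ?thesis .
  qed
  then show "cmod (\<integral>\<omega>. m \<omega> * u \<omega> * v \<omega> \<partial>\<mu>)
      \<le> C * sqrt (\<integral>\<omega>. (cmod (u \<omega>))\<^sup>2 \<partial>\<mu>) * sqrt (\<integral>\<omega>. (cmod (v \<omega>))\<^sup>2 \<partial>\<mu>)"
    by (simp add: a_def b_def)
qed

section \<open>Existence and boundedness of Bessel multipliers\<close>

lemma
  assumes "bessel_bound \<mu> F B" and "(\<lambda>\<omega>. cinner f (F \<omega>)) \<in> borel_measurable \<mu>"
  shows bessel_integrable: "integrable \<mu> (\<lambda>\<omega>. (cmod (cinner f (F \<omega>)))\<^sup>2)"
    and bessel_integral_le: "(\<integral>\<omega>. (cmod (cinner f (F \<omega>)))\<^sup>2 \<partial>\<mu>) \<le> B * (norm f)\<^sup>2"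
proof -
  have le: "(\<integral>\<^sup>+\<omega>. ennreal ((cmod (cinner f (F \<omega>)))\<^sup>2) \<partial>\<mu>) \<le> ennreal (B * (norm f)\<^sup>2)" and "0 \<le> B"
    using assms(1) unfolding bessel_bound_def by blast+
  have meas [measurable]: "(\<lambda>\<omega>. cinner f (F \<omega>)) \<in> borel_measurable \<mu>" by fact
  show "integrable \<mu> (\<lambda>\<omega>. (cmod (cinner f (F \<omega>)))\<^sup>2)"
  proof (rule integrableI_bounded)
    show "(\<integral>\<^sup>+\<omega>. ennreal (norm ((cmod (cinner f (F \<omega>)))\<^sup>2)) \<partial>\<mu>) < \<infinity>"
      using le_less_trans[OF le] by simp
  qed measurable
  have "(\<integral>\<omega>. (cmod (cinner f (F \<omega>)))\<^sup>2 \<partial>\<mu>)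
    = enn2real (\<integral>\<^sup>+\<omega>. ennreal ((cmod (cinner f (F \<omega>)))\<^sup>2) \<partial>\<mu>)"
    by (rule integral_eq_nn_integral) auto
  also have "\<dots> \<le> B * (norm f)\<^sup>2"
    using le \<open>0 \<le> B\<close> by (intro enn2real_leI) auto
  finally show "(\<integral>\<omega>. (cmod (cinner f (F \<omega>)))\<^sup>2 \<partial>\<mu>) \<le> B * (norm f)\<^sup>2" .
qed

text \<open>
  The Bessel bounds and the bound of the symbol are parameters, and \<open>F\<close> and \<open>G\<close> enter
  symmetrically, so that the adjoint multiplier is another instance of the same locale.
\<close>

locale bounded_bessel_symbol =
  fixes \<mu> :: "'w measure" and m :: "'w \<Rightarrow> complex" and F G :: "'w \<Rightarrow> 'h::chilbert_space"
    and C BF BG :: real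
  assumes F_measurable [measurable]: "\<And>f. (\<lambda>\<omega>. cinner f (F \<omega>)) \<in> borel_measurable \<mu>"
    and G_measurable [measurable]: "\<And>f. (\<lambda>\<omega>. cinner f (G \<omega>)) \<in> borel_measurable \<mu>"
    and F_bound: "bessel_bound \<mu> F BF" and G_bound: "bessel_bound \<mu> G BG"
    and m_measurable [measurable]: "m \<in> borel_measurable \<mu>"
    and m_bound: "AE \<omega> in \<mu>. cmod (m \<omega>) \<le> C" and C_nonneg: "0 \<le> C"
begin

lemma BF_nonneg: "0 \<le> BF" and BG_nonneg: "0 \<le> BG"
  using F_bound G_bound by (auto simp: bessel_bound_def)

lemma G_measurable' [measurable]: "(\<lambda>\<omega>. cinner (G \<omega>) g) \<in> borel_measurable \<mu>"
proof -
  have "(\<lambda>\<omega>. cnj (cinner g (G \<omega>))) \<in> borel_measurable \<mu>"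
    by (intro measurable_compose[OF G_measurable] borel_measurable_continuous_onI continuous_intros)
  then show ?thesis by (simp flip: cinner_commute)
qed

lemma F_integrable: "integrable \<mu> (\<lambda>\<omega>. (cmod (cinner f (F \<omega>)))\<^sup>2)"
  by (rule bessel_integrable[OF F_bound F_measurable])

lemma G_integrable: "integrable \<mu> (\<lambda>\<omega>. (cmod (cinner (G \<omega>) g))\<^sup>2)"
  using bessel_integrable[OF G_bound G_measurable] by (simp add: cmod_cinner_commute[of _ g])

lemma sqrt_F_integral_le: "sqrt (\<integral>\<omega>. (cmod (cinner f (F \<omega>)))\<^sup>2 \<partial>\<mu>) \<le> sqrt BF * norm f"
  using real_sqrt_le_mono[OF bessel_integral_le[OF F_bound F_measurable]]
  by (simp add: real_sqrt_mult)

lemma sqrt_G_integral_le: "sqrt (\<integral>\<omega>. (cmod (cinner (G \<omega>) g))\<^sup>2 \<partial>\<mu>) \<le> sqrt BG * norm g"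
  using real_sqrt_le_mono[OF bessel_integral_le[OF G_bound G_measurable]]
  by (simp add: real_sqrt_mult cmod_cinner_commute[of _ g])

lemma integrable_multiplier: "integrable \<mu> (\<lambda>\<omega>. m \<omega> * cinner f (F \<omega>) * cinner (G \<omega>) g)"
  by (rule integrable_weighted_product[OF _ _ _ m_bound C_nonneg F_integrable G_integrable]) auto

text \<open>
  The defining form is conjugate linear in \<open>g\<close>; its conjugate is a bounded linear functional of
  \<open>g\<close>, and the vector representing it is the value of the multiplier at \<open>f\<close>.
\<close>

lemma multiplier_exists: "\<exists>T. is_bessel_multiplier \<mu> m F G T"
proof -
  have "\<exists>z. \<forall>g. cinner z g = (\<integral>\<omega>. m \<omega> * cinner f (F \<omega>) * cinner (G \<omega>) g \<partial>\<mu>)" for f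
  proof -
    define \<phi> where "\<phi> g = cnj (\<integral>\<omega>. m \<omega> * cinner f (F \<omega>) * cinner (G \<omega>) g \<partial>\<mu>)" for g
    have "\<phi> (x + y) = \<phi> x + \<phi> y" for x y
      by (simp add: \<phi>_def cinner_add_right distrib_left integrable_multiplier)
    moreover have "\<phi> (a *\<^sub>C x) = a * \<phi> x" for a x
      by (simp add: \<phi>_def cinner_scaleC_right mult.left_commute[of _ "cnj a"])
    moreover have "cmod (\<phi> g) \<le> (C * (sqrt BF * norm f) * sqrt BG) * norm g" for g
    proof -
      have "cmod (\<phi> g) \<le> C * sqrt (\<integral>\<omega>. (cmod (cinner f (F \<omega>)))\<^sup>2 \<partial>\<mu>)
          * sqrt (\<integral>\<omega>. (cmod (cinner (G \<omega>) g))\<^sup>2 \<partial>\<mu>)"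
        unfolding \<phi>_def complex_mod_cnj
        by (rule weighted_product_Cauchy_Schwarz[OF _ _ _ m_bound C_nonneg F_integrable G_integrable]) auto
      also have "\<dots> \<le> C * (sqrt BF * norm f) * (sqrt BG * norm g)"
        using C_nonneg BF_nonneg by (intro mult_mono mult_left_mono sqrt_F_integral_le sqrt_G_integral_le) auto
      finally show ?thesis by (simp add: mult.assoc)
    qed
    ultimately obtain z where "\<And>g. \<phi> g = cinner g z"
      using Riesz_representation by metis
    then have "cinner z g = cnj (\<phi> g)" for g
      using cinner_commute by metis
    then show ?thesis by (auto simp: \<phi>_def)
  qed
  then obtain T where "\<And>f g. cinner (T f) g = (\<integral>\<omega>. m \<omega> * cinner f (F \<omega>) * cinner (G \<omega>) g \<partial>\<mu>)"
    by metis
  then show ?thesis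
    unfolding is_bessel_multiplier_def using integrable_multiplier by blast
qed

lemma bessel_multiplier: "is_bessel_multiplier \<mu> m F G (bessel_multiplier \<mu> m F G)"
proof -
  have "\<exists>!T. is_bessel_multiplier \<mu> m F G T"
  proof (rule ex_ex1I[OF multiplier_exists])
    fix S T assume "is_bessel_multiplier \<mu> m F G S" "is_bessel_multiplier \<mu> m F G T"
    then have "cinner (S f) g = cinner (T f) g" for f g
      by (simp add: is_bessel_multiplier_def)
    then show "S = T"
      by (metis cinner_eqI ext)
  qed
  then show ?thesis
    unfolding bessel_multiplier_def by (rule theI')
qed

abbreviation M where "M \<equiv> bessel_multiplier \<mu> m F G"

lemma cinner_multiplier: "cinner (M f) g = (\<integral>\<omega>. m \<omega> * cinner f (F \<omega>) * cinner (G \<omega>) g \<partial>\<mu>)"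
  using bessel_multiplier by (simp add: is_bessel_multiplier_def)

lemma multiplier_add: "M (x + y) = M x + M y"
  by (rule cinner_eqI)
    (simp add: cinner_add_left cinner_multiplier distrib_left distrib_right integrable_multiplier)

lemma multiplier_scaleC: "M (a *\<^sub>C x) = a *\<^sub>C M x"
proof (rule cinner_eqI)
  fix g
  have "m \<omega> * (a * cinner x (F \<omega>)) * cinner (G \<omega>) g = a * (m \<omega> * cinner x (F \<omega>) * cinner (G \<omega>) g)" for \<omega>
    by simp
  then show "cinner (M (a *\<^sub>C x)) g = cinner (a *\<^sub>C M x) g"
    by (simp only: cinner_scaleC_left cinner_multiplier integral_mult_right_zero)
qed

lemma multiplier_diff: "M (x - y) = M x - M y"
  using multiplier_add[of "x - y" y] by simp

lemma linear_multiplier: "Vector_Spaces.linear (*\<^sub>C) (*\<^sub>C) M"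
  by (intro Vector_Spaces.linear_iff[THEN iffD2] conjI allI vector_space_scaleC
      multiplier_add multiplier_scaleC)

text \<open>
  In \<open>cinner (M h) (M h)\<close> the factor \<open>cinner h (F \<omega>)\<close> may be cut off to \<open>K\<close>. The Cauchy--Schwarz
  inequality and the Bessel bound of \<open>G\<close> leave one factor \<open>norm (M h)\<close>, which cancels.
\<close>

lemma norm_multiplier_le_on_support:
  assumes [measurable]: "K \<in> sets \<mu>" and supp: "AE \<omega> in \<mu>. \<omega> \<notin> K \<longrightarrow> m \<omega> = 0"
  shows "(norm (M h))\<^sup>2 \<le> C\<^sup>2 * BG * (\<integral>\<omega>. (cmod (indicator K \<omega> * cinner h (F \<omega>)))\<^sup>2 \<partial>\<mu>)"
proof -
  define u where "u \<omega> = indicator K \<omega> * cinner h (F \<omega>)" for \<omega>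
  define I where "I = (\<integral>\<omega>. (cmod (u \<omega>))\<^sup>2 \<partial>\<mu>)"
  have [measurable]: "u \<in> borel_measurable \<mu>"
    unfolding u_def by measurable
  have u: "integrable \<mu> (\<lambda>\<omega>. (cmod (u \<omega>))\<^sup>2)"
    by (rule Bochner_Integration.integrable_bound[OF F_integrable[of h]])
      (auto simp: u_def indicator_def)
  have "(norm (M h))\<^sup>2 = cmod (cinner (M h) (M h))"
    by (simp add: cinner_self del: of_real_power)
  also have "cinner (M h) (M h) = (\<integral>\<omega>. m \<omega> * u \<omega> * cinner (G \<omega>) (M h) \<partial>\<mu>)"
    unfolding cinner_multiplier
  proof (rule integral_cong_AE)
    show "AE \<omega> in \<mu>. m \<omega> * cinner h (F \<omega>) * cinner (G \<omega>) (M h) = m \<omega> * u \<omega> * cinner (G \<omega>) (M h)"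
      using supp by eventually_elim (auto simp: u_def indicator_def)
  qed measurable
  also have "cmod \<dots> \<le> C * sqrt I * sqrt (\<integral>\<omega>. (cmod (cinner (G \<omega>) (M h)))\<^sup>2 \<partial>\<mu>)"
    unfolding I_def
    by (rule weighted_product_Cauchy_Schwarz[OF _ _ _ m_bound C_nonneg u G_integrable]) auto
  also have "\<dots> \<le> C * sqrt I * (sqrt BG * norm (M h))"
    using C_nonneg by (intro mult_left_mono sqrt_G_integral_le) (simp add: I_def)
  finally have "norm (M h) * norm (M h) \<le> (C * sqrt I * sqrt BG) * norm (M h)"
    by (simp add: power2_eq_square mult.assoc)
  then have "norm (M h) \<le> C * sqrt I * sqrt BG"
    using C_nonneg BG_nonneg by (cases "M h = 0") (auto simp: I_def)
  then have "(norm (M h))\<^sup>2 \<le> (C * sqrt I * sqrt BG)\<^sup>2"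
    by (rule power_mono) simp
  also have "\<dots> = C\<^sup>2 * BG * I"
    using BG_nonneg by (simp add: power_mult_distrib I_def)
  finally show ?thesis by (simp add: I_def u_def)
qed

lemma norm_multiplier_le: "norm (M h) \<le> C * sqrt (BG * BF) * norm h"
proof -
  have "(norm (M h))\<^sup>2 \<le> C\<^sup>2 * BG * (\<integral>\<omega>. (cmod (indicator (space \<mu>) \<omega> * cinner h (F \<omega>)))\<^sup>2 \<partial>\<mu>)"
    by (rule norm_multiplier_le_on_support) auto
  also have "(\<integral>\<omega>. (cmod (indicator (space \<mu>) \<omega> * cinner h (F \<omega>)))\<^sup>2 \<partial>\<mu>)
      = (\<integral>\<omega>. (cmod (cinner h (F \<omega>)))\<^sup>2 \<partial>\<mu>)"
    by (rule Bochner_Integration.integral_cong) auto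
  also have "C\<^sup>2 * BG * \<dots> \<le> C\<^sup>2 * BG * (BF * (norm h)\<^sup>2)"
    using BG_nonneg by (intro mult_left_mono bessel_integral_le[OF F_bound F_measurable]) auto
  also have "\<dots> = (C * sqrt (BG * BF) * norm h)\<^sup>2"
    using BG_nonneg BF_nonneg by (simp add: power_mult_distrib)
  finally show ?thesis
    by (rule power2_le_imp_le) (use C_nonneg BG_nonneg BF_nonneg in simp)
qed

section \<open>Compactness\<close>

text \<open>
  Along a weakly convergent subsequence the functions \<open>u n\<close>, the inner products with \<open>F \<omega>\<close> cut
  off to \<open>K\<close>, converge everywhere to some \<open>l\<close> and are dominated by a multiple of the indicator of
  \<open>K\<close>. So they converge in \<open>L\<^sup>2\<close>, and \<open>norm_multiplier_le_on_support\<close> transfers this to the images.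
\<close>

lemma multiplier_Cauchy_subseq_if_F_bounded:
  assumes K [measurable]: "K \<in> sets \<mu>" and fin: "emeasure \<mu> K < \<infinity>"
    and supp: "AE \<omega> in \<mu>. \<omega> \<notin> K \<longrightarrow> m \<omega> = 0"
    and F: "AE \<omega> in \<mu>. norm (F \<omega>) \<le> D"
    and f: "\<And>n. norm (f n) \<le> L"
  shows "\<exists>r :: nat \<Rightarrow> nat. strict_mono r \<and> Cauchy (\<lambda>n. M (f (r n)))"
proof -
  obtain r where r: "strict_mono r" and conv: "\<And>h. convergent (\<lambda>n. cinner (f (r n)) h)"
    using bounded_seq_weakly_convergent_subseq[of f L, OF f] by blast
  have "0 \<le> L" using f[of 0] norm_ge_zero order_trans by blast
  define u where "u n \<omega> = indicator K \<omega> * cinner (f (r n)) (F \<omega>)" for n \<omega>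
  define l where "l \<omega> = lim (\<lambda>n. u n \<omega>)" for \<omega>
  have [measurable]: "u n \<in> borel_measurable \<mu>" for n
    unfolding u_def by measurable
  have [measurable]: "l \<in> borel_measurable \<mu>"
    unfolding l_def by measurable
  have lim: "(\<lambda>n. u n \<omega>) \<longlonglongrightarrow> l \<omega>" for \<omega>
    unfolding l_def u_def convergent_LIMSEQ_iff[symmetric]
    by (intro convergent_mult convergent_const conv)
  have bound: "AE \<omega> in \<mu>. \<forall>n. cmod (u n \<omega>) \<le> L * D * indicator K \<omega>"
    using F
  proof eventually_elim
    case (elim \<omega>)
    have "cmod (cinner (f (r n)) (F \<omega>)) \<le> L * D" for n
      using cinner_Cauchy_Schwarz[of "f (r n)" "F \<omega>"] mult_mono[OF f[of "r n"] elim \<open>0 \<le> L\<close>] by simp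
    then show ?case by (auto simp: u_def indicator_def)
  qed
  define w where "w \<omega> = (2 * (L * D))\<^sup>2 * indicator K \<omega>" for \<omega> :: 'w
  have w: "integrable \<mu> w"
    unfolding w_def using fin by simp
  have sq_bound: "AE \<omega> in \<mu>. (cmod (u n \<omega> - l \<omega>))\<^sup>2 \<le> w \<omega>" for n
    using bound
  proof eventually_elim
    case (elim \<omega>)
    have "cmod (l \<omega>) \<le> L * D * indicator K \<omega>"
      by (rule LIMSEQ_le_const2[OF tendsto_norm[OF lim]]) (use elim in auto)
    then have "cmod (u n \<omega> - l \<omega>) \<le> 2 * (L * D) * indicator K \<omega>"
      using norm_triangle_ineq4[of "u n \<omega>" "l \<omega>"] elim[rule_format, of n] by simp
    then have "(cmod (u n \<omega> - l \<omega>))\<^sup>2 \<le> (2 * (L * D) * indicator K \<omega>)\<^sup>2"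
      by (rule power_mono) simp
    then show ?case by (cases "\<omega> \<in> K") (simp_all add: w_def)
  qed
  define d where "d n = (\<integral>\<omega>. (cmod (u n \<omega> - l \<omega>))\<^sup>2 \<partial>\<mu>)" for n
  have int_d: "integrable \<mu> (\<lambda>\<omega>. (cmod (u n \<omega> - l \<omega>))\<^sup>2)" for n
  proof (rule Bochner_Integration.integrable_bound[OF w])
    show "AE \<omega> in \<mu>. norm ((cmod (u n \<omega> - l \<omega>))\<^sup>2) \<le> norm (w \<omega>)"
      using sq_bound[of n] by eventually_elim simp
  qed measurable
  have "d \<longlonglongrightarrow> (\<integral>\<omega>. 0 \<partial>\<mu>)"
    unfolding d_def
  proof (rule integral_dominated_convergence[OF _ _ w])
    show "AE \<omega> in \<mu>. (\<lambda>n. (cmod (u n \<omega> - l \<omega>))\<^sup>2) \<longlonglongrightarrow> 0"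
    proof (rule AE_I2)
      fix \<omega>
      have "(\<lambda>n. (cmod (u n \<omega> - l \<omega>))\<^sup>2) \<longlonglongrightarrow> (cmod (l \<omega> - l \<omega>))\<^sup>2"
        by (intro tendsto_intros lim)
      then show "(\<lambda>n. (cmod (u n \<omega> - l \<omega>))\<^sup>2) \<longlonglongrightarrow> 0" by simp
    qed
  qed (use sq_bound in auto)
  then have d: "d \<longlonglongrightarrow> 0" by simp
  have "(norm (M (f (r n)) - M (f (r k))))\<^sup>2 \<le> 2 * C\<^sup>2 * BG * d n + 2 * C\<^sup>2 * BG * d k" for n k
  proof -
    have "(norm (M (f (r n) - f (r k))))\<^sup>2
        \<le> C\<^sup>2 * BG * (\<integral>\<omega>. (cmod (indicator K \<omega> * cinner (f (r n) - f (r k)) (F \<omega>)))\<^sup>2 \<partial>\<mu>)"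
      by (rule norm_multiplier_le_on_support[OF K supp])
    also have "\<dots> = C\<^sup>2 * BG * (\<integral>\<omega>. (cmod (u n \<omega> - u k \<omega>))\<^sup>2 \<partial>\<mu>)"
      by (simp add: u_def cinner_diff_left right_diff_distrib)
    also have "\<dots> \<le> C\<^sup>2 * BG * (2 * d n + 2 * d k)"
    proof (rule mult_left_mono)
      have pointwise: "(cmod (u n \<omega> - u k \<omega>))\<^sup>2
          \<le> 2 * (cmod (u n \<omega> - l \<omega>))\<^sup>2 + 2 * (cmod (u k \<omega> - l \<omega>))\<^sup>2" for \<omega>
        using norm_diff_squared_le[of "u n \<omega> - l \<omega>" "u k \<omega> - l \<omega>"] by simp
      have "(\<integral>\<omega>. (cmod (u n \<omega> - u k \<omega>))\<^sup>2 \<partial>\<mu>)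
          \<le> (\<integral>\<omega>. 2 * (cmod (u n \<omega> - l \<omega>))\<^sup>2 + 2 * (cmod (u k \<omega> - l \<omega>))\<^sup>2 \<partial>\<mu>)"
        by (rule integral_mono_AE') (use pointwise int_d in auto)
      then show "(\<integral>\<omega>. (cmod (u n \<omega> - u k \<omega>))\<^sup>2 \<partial>\<mu>) \<le> 2 * d n + 2 * d k"
        by (simp add: d_def int_d)
    qed (use BG_nonneg in simp)
    finally show ?thesis
      by (simp add: multiplier_diff algebra_simps)
  qed
  moreover have "(\<lambda>n. 2 * C\<^sup>2 * BG * d n) \<longlonglongrightarrow> 0"
    by (rule tendsto_mult_right_zero[OF d])
  ultimately have "Cauchy (\<lambda>n. M (f (r n)))"
    by (rule Cauchy_if_norm_squared_le)
  with r show ?thesis by blast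
qed

lemma adjoint_data: "bounded_bessel_symbol \<mu> (\<lambda>\<omega>. cnj (m \<omega>)) G F C BG BF"
proof
  show "(\<lambda>\<omega>. cnj (m \<omega>)) \<in> borel_measurable \<mu>"
    by (intro measurable_compose[OF m_measurable] borel_measurable_continuous_onI continuous_intros)
qed (use F_bound G_bound m_bound C_nonneg in auto)

lemma cinner_multiplier_adjoint:
  "cinner (M f) g = cinner f (bessel_multiplier \<mu> (\<lambda>\<omega>. cnj (m \<omega>)) G F g)"
proof -
  interpret adj: bounded_bessel_symbol \<mu> "\<lambda>\<omega>. cnj (m \<omega>)" G F C BG BF
    by (rule adjoint_data)
  have "cinner f (adj.M g) = cnj (cinner (adj.M g) f)"
    by (rule cinner_commute)
  also have "\<dots> = (\<integral>\<omega>. cnj (cnj (m \<omega>) * cinner g (G \<omega>) * cinner (F \<omega>) f) \<partial>\<mu>)"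
    unfolding adj.cinner_multiplier by (rule Bochner_Integration.integral_cnj[symmetric])
  also have "\<dots> = cinner (M f) g"
    unfolding cinner_multiplier
    by (rule Bochner_Integration.integral_cong)
      (simp_all add: cinner_commute[of f] cinner_commute[of _ g])
  finally show ?thesis by simp
qed

text \<open>
  The adjoint is compact by the previous case and the multiplier is bounded, so a subsequence
  converges after applying both. Since
  \<open>norm (M h) ^ 2 = cinner h (adj.M (M h)) \<le> norm h * norm (adj.M (M h))\<close>, the images under \<open>M\<close>
  alone form a Cauchy sequence.
\<close>

lemma multiplier_Cauchy_subseq_if_G_bounded:
  assumes K: "K \<in> sets \<mu>" "emeasure \<mu> K < \<infinity>"
    and supp: "AE \<omega> in \<mu>. \<omega> \<notin> K \<longrightarrow> m \<omega> = 0"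
    and G: "AE \<omega> in \<mu>. norm (G \<omega>) \<le> D"
    and f: "\<And>n. norm (f n) \<le> L"
  shows "\<exists>r :: nat \<Rightarrow> nat. strict_mono r \<and> Cauchy (\<lambda>n. M (f (r n)))"
proof -
  interpret adj: bounded_bessel_symbol \<mu> "\<lambda>\<omega>. cnj (m \<omega>)" G F C BG BF
    by (rule adjoint_data)
  have "norm (M (f n)) \<le> C * sqrt (BG * BF) * L" for n
    using norm_multiplier_le[of "f n"] mult_left_mono[OF f[of n], of "C * sqrt (BG * BF)"]
      C_nonneg BF_nonneg BG_nonneg by simp
  moreover have "AE \<omega> in \<mu>. \<omega> \<notin> K \<longrightarrow> cnj (m \<omega>) = 0"
    using supp by simp
  ultimately obtain r where r: "strict_mono r" and cauchy: "Cauchy (\<lambda>n. adj.M (M (f (r n))))"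
    using adj.multiplier_Cauchy_subseq_if_F_bounded[OF K _ G, of "\<lambda>n. M (f n)"] by blast
  then obtain l where l: "(\<lambda>n. adj.M (M (f (r n)))) \<longlonglongrightarrow> l"
    using Cauchy_convergent convergent_def by blast
  have "0 \<le> L" using f[of 0] norm_ge_zero order_trans by blast
  define a where "a n = 2 * L * norm (adj.M (M (f (r n))) - l)" for n
  have "(norm (M (f (r n)) - M (f (r k))))\<^sup>2 \<le> a n + a k" for n k
  proof -
    define h where "h = f (r n) - f (r k)"
    have h: "norm h \<le> 2 * L"
      using norm_triangle_ineq4[of "f (r n)" "f (r k)"] f[of "r n"] f[of "r k"] by (simp add: h_def)
    have "(norm (M h))\<^sup>2 = cmod (cinner (M h) (M h))"
      by (simp add: cinner_self del: of_real_power)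
    also have "\<dots> = cmod (cinner h (adj.M (M h)))"
      by (simp only: cinner_multiplier_adjoint)
    also have "\<dots> \<le> norm h * norm (adj.M (M h))"
      by (rule cinner_Cauchy_Schwarz)
    also have "\<dots> \<le> 2 * L * norm (adj.M (M h))"
      using h by (rule mult_right_mono) simp
    also have "adj.M (M h) = (adj.M (M (f (r n))) - l) - (adj.M (M (f (r k))) - l)"
      by (simp add: h_def multiplier_diff adj.multiplier_diff)
    also have "2 * L * norm \<dots> \<le> 2 * L * (norm (adj.M (M (f (r n))) - l) + norm (adj.M (M (f (r k))) - l))"
      using \<open>0 \<le> L\<close> by (intro mult_left_mono norm_triangle_ineq4) simp
    finally show ?thesis
      by (simp add: h_def multiplier_diff a_def distrib_left)
  qed
  moreover have "a \<longlonglongrightarrow> 0"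
    unfolding a_def using l by (intro tendsto_mult_right_zero) (simp add: LIM_zero tendsto_norm_zero)
  ultimately have "Cauchy (\<lambda>n. M (f (r n)))"
    by (rule Cauchy_if_norm_squared_le)
  with r show ?thesis by blast
qed

lemma compact_operator_multiplier:
  assumes K: "K \<in> sets \<mu>" "emeasure \<mu> K < \<infinity>"
    and supp: "AE \<omega> in \<mu>. \<omega> \<notin> K \<longrightarrow> m \<omega> = 0"
    and bounded: "ae_norm_bounded \<mu> F \<or> ae_norm_bounded \<mu> G"
  shows "compact_operator M"
proof -
  have "compact (closure (M ` cball 0 1))"
  proof (rule compact_closure_if_Cauchy_subseq)
    fix x :: "nat \<Rightarrow> 'h" assume "\<And>n. x n \<in> M ` cball 0 1"
    then have "\<forall>n. \<exists>y. x n = M y \<and> norm y \<le> 1" by fastforce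
    then obtain f where x: "\<And>n. x n = M (f n)" and f: "\<And>n. norm (f n) \<le> 1"
      by metis
    have "\<exists>r. strict_mono r \<and> Cauchy (\<lambda>n. M (f (r n)))"
      using bounded
    proof
      assume "ae_norm_bounded \<mu> F"
      then obtain D where "AE \<omega> in \<mu>. norm (F \<omega>) \<le> D"
        by (auto simp: ae_norm_bounded_def)
      then show ?thesis
        by (rule multiplier_Cauchy_subseq_if_F_bounded[where f = f, OF K supp _ f])
    next
      assume "ae_norm_bounded \<mu> G"
      then obtain D where "AE \<omega> in \<mu>. norm (G \<omega>) \<le> D"
        by (auto simp: ae_norm_bounded_def)
      then show ?thesis
        by (rule multiplier_Cauchy_subseq_if_G_bounded[where f = f, OF K supp _ f])
    qed
    then show "\<exists>r. strict_mono r \<and> Cauchy (x \<circ> r)"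
      by (simp add: comp_def x)
  qed
  with linear_multiplier show ?thesis by (simp add: compact_operator_def)
qed

end

theorem theorem3p7:
  fixes \<mu> :: "'w measure"
    and F G :: "'w \<Rightarrow> 'h::chilbert_space"
    and m :: "'w \<Rightarrow> complex"
  assumes "bessel_mapping \<mu> F" and "bessel_mapping \<mu> G"
    and "ae_norm_bounded \<mu> F \<or> ae_norm_bounded \<mu> G"
    and "m \<in> borel_measurable \<mu>"
    and "\<exists>C. AE \<omega> in \<mu>. cmod (m \<omega>) \<le> C"
    and "\<exists>K\<in>sets \<mu>. emeasure \<mu> K < \<infinity> \<and> (AE \<omega> in \<mu>. \<omega> \<notin> K \<longrightarrow> m \<omega> = 0)"
  shows "compact_operator (bessel_multiplier \<mu> m F G)"
proof -
  obtain BF BG where bounds: "bessel_bound \<mu> F BF" "bessel_bound \<mu> G BG"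
    using assms(1,2) by (auto simp: bessel_mapping_def)
  obtain C where "AE \<omega> in \<mu>. cmod (m \<omega>) \<le> C"
    using assms(5) by blast
  \<comment> \<open>On a null space the essential bound \<open>C\<close> could be negative.\<close>
  then have "AE \<omega> in \<mu>. cmod (m \<omega>) \<le> max 0 C"
    by eventually_elim simp
  then interpret bounded_bessel_symbol \<mu> m F G "max 0 C" BF BG
    using assms(1,2,4) bounds by unfold_locales (auto simp: bessel_mapping_def)
  show ?thesis
    using assms(3,6) compact_operator_multiplier by blast
qed

end
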